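(* Let $\mathcal{S}$ be a self-adjoint (multiplicative) semigroup of nonnegative $n \times n$ matrices (i.e. matrices with nonnegative real entries) such that the set $\{ \operatorname{tr} S : S \in \mathcal{S}_+ \}$ is finite, where $\mathcal{S}_+$ denotes the set of all positive semidefinite matrices in $\mathcal{S}$. Then nonzero entries of matrices in $\mathcal{S}$ are of the form $\sqrt{\xi \eta}$, where $\xi$ and $\eta$ are diagonal values (entries) of some matrices in $P(\mathcal{S})$, the set of all projections in $\mathcal{S}$. In particular, $\mathcal{S}$ is finite.
   Context: A collection $\mathcal{C}$ of matrices is called self-adjoint if $T \in \mathcal{C}$ implies $T^* \in \mathcal{C}$, where $T^*$ is the conjugate transpose of $T$. A projection is a self-adjoint idempotent. *)

theory Defs
  imports "HOL-Analysis.Analysis"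
begin

text \<open>All matrices considered have real entries, so the conjugate transpose of \<open>A\<close> is
  \<open>transpose A\<close>.\<close>

definition nonneg_matrix :: "real^'n^'n \<Rightarrow> bool" where
  "nonneg_matrix A \<longleftrightarrow> (\<forall>i j. 0 \<le> A $ i $ j)"

definition mult_semigroup :: "(real^'n^'n) set \<Rightarrow> bool" where
  "mult_semigroup \<S> \<longleftrightarrow> (\<forall>A\<in>\<S>. \<forall>B\<in>\<S>. A ** B \<in> \<S>)"

definition selfadjoint_collection :: "(real^'n^'n) set \<Rightarrow> bool" where
  "selfadjoint_collection \<C> \<longleftrightarrow> (\<forall>T\<in>\<C>. transpose T \<in> \<C>)"

text \<open>Over the reals, nonnegativity of the quadratic form does not imply symmetry, so symmetry is
  part of the definition (as it is automatically for complex quadratic forms).\<close>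

definition pos_semidef :: "real^'n^'n \<Rightarrow> bool" where
  "pos_semidef A \<longleftrightarrow> transpose A = A \<and> (\<forall>x. 0 \<le> x \<bullet> (A *v x))"

definition projection_matrix :: "real^'n^'n \<Rightarrow> bool" where
  "projection_matrix P \<longleftrightarrow> transpose P = P \<and> P ** P = P"

definition pos_part :: "(real^'n^'n) set \<Rightarrow> (real^'n^'n) set" where
  "pos_part \<S> = {S \<in> \<S>. pos_semidef S}"

definition projections :: "(real^'n^'n) set \<Rightarrow> (real^'n^'n) set" where
  "projections \<S> = {P \<in> \<S>. projection_matrix P}"

definition diagonal_values :: "(real^'n^'n) set \<Rightarrow> real set" where
  "diagonal_values \<C> = {P $ k $ k | P k. P \<in> \<C>}"

end

theory Submission
  imports Defs
begin

text \<open>For \<open>T \<in> \<S>\<close> put \<open>A = T\<^sup>* T\<close>. The traces of the powers of \<open>A\<close> form a convex sequence, since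
  their second differences are squared Frobenius norms. A convex sequence with finitely many values
  has a vanishing second difference, which forces \<open>A\<close> to be a projection; thus every
  \<open>T \<in> \<S>\<close> is a partial isometry. Nonnegative projections are direct sums of rank one blocks, and \<open>T\<close> maps
  blocks to blocks, which gives \<open>T\<^sub>k\<^sub>l\<^sup>2 = (T T\<^sup>*)\<^sub>k\<^sub>k (T\<^sup>* T)\<^sub>l\<^sub>l\<close> for nonzero entries. Finally the
  squared distance of projections \<open>P, Q\<close> is \<open>tr P + tr Q - 2 tr ((P Q)\<^sup>* (P Q))\<close>, which takes finitely
  many values, so there are only finitely many projections in \<open>\<S>\<close>.\<close>

section \<open>Matrix powers, traces and Gram matrices\<close>

abbreviation mat_power :: "real^'n^'n \<Rightarrow> nat \<Rightarrow> real^'n^'n" where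
  "mat_power A k \<equiv> ((**) A ^^ k) (mat 1)"

lemma mat_power_add: "mat_power A (k + l) = mat_power A k ** mat_power A l"
  by (induction k) (simp_all add: matrix_mul_assoc)

lemma mat_power_Suc_right: "mat_power A (Suc k) = mat_power A k ** A"
  using mat_power_add[of k 1 A] by simp

lemma transpose_mat_power: "transpose (mat_power A k) = mat_power (transpose A) k"
proof (induction k)
  case (Suc k)
  have "transpose (mat_power A (Suc k)) = transpose (mat_power A k) ** transpose A"
    by (simp add: matrix_transpose_mul)
  then show ?case
    by (simp only: Suc mat_power_Suc_right)
qed simp

text \<open>The inner product of nested vectors is the Frobenius product, so traces of Gram matrices
  become squared norms.\<close>

lemma trace_transpose_mult:
  fixes X Y :: "real^'n^'m"
  shows "trace (transpose X ** Y) = X \<bullet> Y"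
  unfolding trace_def matrix_matrix_mult_def transpose_def inner_vec_def
  by (simp, rule sum.swap)

lemma pos_semidef_transpose_mult: "pos_semidef (transpose X ** X)"
proof -
  have "x \<bullet> ((transpose X ** X) *v x) = (X *v x) \<bullet> (X *v x)" for x
    by (metis dot_lmul_matrix inner_commute matrix_vector_mul_assoc transpose_matrix_vector)
  then show ?thesis
    unfolding pos_semidef_def by (simp add: matrix_transpose_mul)
qed

text \<open>Induction in steps of two: for symmetric \<open>A\<close>, a factor \<open>X\<close> of
  one power gives the factor \<open>X ** A\<close> two exponents later. The factors yield both
  semidefiniteness of the powers and the second differences of their traces.\<close>

lemma mat_power_gram:
  fixes T :: "real^'n^'n"
  shows "\<exists>X :: real^'n^'n. mat_power (transpose T ** T) k = transpose X ** X"
proof (induction k rule: induct_nat_012)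
  case 0
  show ?case by (rule exI[of _ "mat 1"]) simp
next
  case 1
  show ?case by (rule exI[of _ T]) simp
next
  case (ge2 k)
  let ?A = "transpose T ** T"
  from ge2 obtain X :: "real^'n^'n" where X: "mat_power ?A k = transpose X ** X" by blast
  have "mat_power ?A (Suc (Suc k)) = ?A ** (transpose X ** X) ** ?A"
    using mat_power_Suc_right[of "Suc k" ?A] X by (simp add: matrix_mul_assoc)
  also have "\<dots> = transpose (X ** ?A) ** (X ** ?A)"
    by (simp add: matrix_transpose_mul matrix_mul_assoc)
  finally show ?case by blast
qed

text \<open>The three traces are the Frobenius products of \<open>X\<close> with \<open>X\<close>,
  of \<open>X\<close> with \<open>X ** A\<close>, and of \<open>X ** A\<close> with itself. If the
  difference vanishes, then \<open>X = X ** A\<close>.\<close>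

lemma second_difference_trace_mat_power:
  assumes "transpose A = A" "mat_power A k = transpose X ** X"
  shows "trace (mat_power A k) - 2 * trace (mat_power A (Suc k)) + trace (mat_power A (Suc (Suc k)))
    = (X - X ** A) \<bullet> (X - X ** A)"
proof -
  have "X \<bullet> (X ** A) = trace (mat_power A (Suc k))"
    unfolding trace_transpose_mult[symmetric] mat_power_Suc_right assms(2)
    by (simp add: matrix_mul_assoc)
  moreover have "(X ** A) \<bullet> (X ** A) = trace (mat_power A (Suc (Suc k)))"
  proof -
    have "(X ** A) \<bullet> (X ** A) = trace (A ** mat_power A k ** A)"
      unfolding trace_transpose_mult[symmetric] matrix_transpose_mul assms
      by (simp add: matrix_mul_assoc)
    also have "A ** mat_power A k ** A = mat_power A (Suc (Suc k))"
      by (metis mat_power_Suc_right comp_apply funpow.simps(2))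
    finally show ?thesis .
  qed
  moreover have "X \<bullet> X = trace (mat_power A k)"
    unfolding trace_transpose_mult[symmetric] assms(2) ..
  ultimately show ?thesis
    by (simp add: inner_diff_left inner_diff_right inner_commute)
qed

section \<open>From finitely many traces to idempotency\<close>

lemma convex_seq_finite_range:
  fixes a :: "nat \<Rightarrow> real"
  assumes "finite (range a)" and "\<And>k. 0 \<le> a k - 2 * a (Suc k) + a (Suc (Suc k))"
  shows "\<exists>k. a k - 2 * a (Suc k) + a (Suc (Suc k)) = 0"
proof (rule ccontr)
  assume *: "\<not> ?thesis"
  let ?d = "\<lambda>k. a (Suc k) - a k"
  \<comment> \<open>If no second difference vanishes, the first differences increase strictly, yet
    they take only finitely many values.\<close>
  have "?d k < ?d (Suc k)" for k
    using assms(2)[of k] * by (smt (verit))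
  then have "inj ?d"
    by (intro strict_mono_imp_inj_on) (simp add: strict_mono_Suc_iff)
  moreover have "range ?d \<subseteq> (\<lambda>(x, y). x - y) ` (range a \<times> range a)"
    by auto
  then have "finite (range ?d)"
    using assms(1) by (blast intro: finite_subset)
  ultimately show False
    using range_inj_infinite by blast
qed

text \<open>The exponent descends by one at a time. With \<open>X = mat_power A (Suc k)\<close>, the
  Gram matrix of \<open>X\<close> is the power \<open>2 * Suc k\<close>. This exponent is at least
  \<open>Suc (Suc k)\<close>, where the powers are already constant, so the second difference there
  is zero and \<open>X = X ** A\<close>.\<close>

lemma symmetric_power_fixed_imp_idempotent:
  assumes "transpose A = A" "mat_power A (Suc k) = mat_power A (Suc (Suc k))"
  shows "A ** A = A"
  using assms(2)
proof (induction k)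
  case 0
  then show ?case by simp
next
  case (Suc k)
  let ?X = "mat_power A (Suc k)"
  have "mat_power A (2 * Suc k) = transpose ?X ** ?X"
    using mat_power_add[of "Suc k" "Suc k" A] transpose_mat_power[of "Suc k" A] assms(1)
    by (simp only: mult_2)
  note second_difference_trace_mat_power[OF assms(1) this]
  moreover have c: "mat_power A (Suc (Suc k) + l) = mat_power A (Suc (Suc (Suc k)) + l)" for l
    unfolding mat_power_add Suc ..
  have "mat_power A (2 * Suc k) = mat_power A (Suc (2 * Suc k))"
    "mat_power A (Suc (2 * Suc k)) = mat_power A (Suc (Suc (2 * Suc k)))"
    using c[of k] c[of "Suc k"] by (simp_all only: mult_2 add_Suc add_Suc_right)
  ultimately have "?X = ?X ** A"
    by simp
  then show ?case
    by (intro Suc.IH) (metis mat_power_Suc_right)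
qed

text \<open>Exponents start at 1 because the power 0 is the identity, which need not lie in the
  semigroup.\<close>

lemma gram_projection_if_finite_traces:
  fixes T :: "real^'n^'n"
  assumes "finite (range (\<lambda>k. trace (mat_power (transpose T ** T) (Suc k))))"
  shows "projection_matrix (transpose T ** T)"
proof -
  let ?A = "transpose T ** T"
  have sym: "transpose ?A = ?A" by (simp add: matrix_transpose_mul)
  obtain X :: "nat \<Rightarrow> real^'n^'n" where X: "\<And>k. mat_power ?A k = transpose (X k) ** X k"
    using mat_power_gram by metis
  note diff = second_difference_trace_mat_power[OF sym X]
  obtain k where "(X (Suc k) - X (Suc k) ** ?A) \<bullet> (X (Suc k) - X (Suc k) ** ?A) = 0"
    using convex_seq_finite_range[OF assms] diff by (metis inner_ge_zero)
  then have "X (Suc k) = X (Suc k) ** ?A" by simp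
  then have "mat_power ?A (Suc k) = mat_power ?A (Suc (Suc k))"
    by (metis X mat_power_Suc_right matrix_mul_assoc)
  then show ?thesis
    using symmetric_power_fixed_imp_idempotent[OF sym] sym by (simp add: projection_matrix_def)
qed

section \<open>Rows of nonnegative projections and entries of partial isometries\<close>

text \<open>Here \<open>E\<close> maps \<open>x - t *\<^sub>R E $ l\<close> to itself, where \<open>t\<close> is the least ratio
  \<open>x $ c / E $ l $ c\<close>; this vector is nonnegative and vanishes at some \<open>c\<close> in the support of
  \<open>E $ l\<close>, hence it vanishes wherever row \<open>c\<close> of \<open>E\<close> is positive.\<close>

lemma nonneg_projection_fixed_vector:
  fixes E :: "real^'n^'n"
  assumes E: "nonneg_matrix E" "projection_matrix E"
    and x: "E *v x = x" and supp: "\<And>c. x $ c > 0 \<Longrightarrow> E $ l $ c > 0"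
    and nn: "\<And>c. x $ c \<ge> 0" and l: "E $ l $ l > 0"
  shows "\<exists>t. x = t *\<^sub>R E $ l"
proof -
  let ?e = "E $ l"
  have pos: "E $ i $ j \<ge> 0" for i j using E by (simp add: nonneg_matrix_def)
  have sym: "E $ i $ j = E $ j $ i" for i j
    using E(2) unfolding projection_matrix_def transpose_def by (metis vec_lambda_beta)
  have idem: "E $ i $ j = (\<Sum>m\<in>UNIV. E $ i $ m * E $ m $ j)" for i j
  proof -
    have "(E ** E) $ i $ j = (\<Sum>m\<in>UNIV. E $ i $ m * E $ m $ j)"
      by (simp add: matrix_matrix_mult_def)
    then show ?thesis using E(2) by (simp add: projection_matrix_def)
  qed
  define C where "C = {c. ?e $ c > 0}"
  define t where "t = Min ((\<lambda>c. x $ c / ?e $ c) ` C)"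
  have "finite C" and "C \<noteq> {}" using l by (auto simp: C_def)
  then have "t \<in> (\<lambda>c. x $ c / ?e $ c) ` C"
    unfolding t_def by (intro Min_in) auto
  then obtain c where c: "c \<in> C" "t = x $ c / ?e $ c" by auto
  have tmin: "t * ?e $ d \<le> x $ d" if "d \<in> C" for d
  proof -
    have "t \<le> x $ d / ?e $ d" unfolding t_def using that by (intro Min_le) auto
    then show ?thesis using that by (simp add: C_def field_simps)
  qed
  define z where "z = x - t *\<^sub>R ?e"
  have off: "x $ d = 0 \<and> ?e $ d = 0" if "d \<notin> C" for d
    using that supp[of d] nn[of d] pos[of l d] by (fastforce simp: C_def not_less)
  have znn: "z $ d \<ge> 0" for d
    using tmin[of d] off[of d] by (cases "d \<in> C") (auto simp: z_def)
  have Ee: "E *v ?e = ?e"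
    by (simp add: vec_eq_iff matrix_vector_mult_def sym[of l] idem[of _ l, symmetric])
  have "E *v z = z"
    using x Ee by (simp add: z_def matrix_vector_mult_diff_distrib matrix_vector_mult_scaleR)
  then have "(\<Sum>d\<in>UNIV. E $ c $ d * z $ d) = z $ c"
    by (simp add: vec_eq_iff matrix_vector_mult_def)
  also have "z $ c = 0" using c by (simp add: z_def C_def)
  finally have zero: "E $ c $ d * z $ d = 0" for d
    using pos znn by (subst (asm) sum_nonneg_eq_0_iff) auto
  have "z $ d = 0" for d
  proof (cases "d \<in> C")
    case True
    \<comment> \<open>Row \<open>c\<close> is positive on all of \<open>C\<close>, since the index
      \<open>l\<close> contributes a positive summand to the idempotency sum for
      \<open>E $ c $ d\<close>.\<close>
    have "0 < E $ c $ l * E $ l $ d" using True c(1) sym[of c l] by (simp add: C_def)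
    also have "\<dots> \<le> E $ c $ d"
      unfolding idem[of c d] using pos by (intro member_le_sum) auto
    finally show ?thesis using zero[of d] by auto
  qed (use off z_def in simp)
  then have "x = t *\<^sub>R ?e" by (simp add: z_def vec_eq_iff)
  then show ?thesis ..
qed

text \<open>Row \<open>k\<close> of \<open>T\<close> is fixed by \<open>E\<close>, the Gram matrix
  of \<open>T\<close>, and supported where row \<open>l\<close> of \<open>E\<close> is positive,
  hence equals \<open>t *\<^sub>R E $ l\<close>. Comparing squared norms and entries at
  \<open>l\<close>, then eliminating \<open>t\<close>, gives the formula.\<close>

lemma nonneg_partial_isometry_entry:
  fixes T :: "real^'n^'n"
  assumes nn: "nonneg_matrix T" and P: "projection_matrix (transpose T ** T)"
    and kl: "T $ k $ l \<noteq> 0"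
  shows "T $ k $ l = sqrt ((T ** transpose T) $ k $ k * (transpose T ** T) $ l $ l)"
proof -
  let ?E = "transpose T ** T"
  have pos: "T $ i $ j \<ge> 0" for i j using nn by (simp add: nonneg_matrix_def)
  have Eij: "?E $ i $ j = (\<Sum>m\<in>UNIV. T $ m $ i * T $ m $ j)" for i j
    by (simp add: matrix_matrix_mult_def transpose_def)
  have Enn: "nonneg_matrix ?E" using pos by (auto simp: nonneg_matrix_def Eij intro!: sum_nonneg)
  have Esym: "transpose ?E = ?E" and Eidem: "?E ** ?E = ?E"
    using P by (auto simp: projection_matrix_def)
  have low: "T $ k $ i * T $ k $ j \<le> ?E $ i $ j" for i j
    unfolding Eij using pos by (intro member_le_sum) auto
  have Tkl: "T $ k $ l > 0" using pos[of k l] kl by simp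
  \<comment> \<open>Exponent 1 with Gram factor \<open>T\<close>: the first three powers of the
    idempotent coincide.\<close>
  have "(T - T ** ?E) \<bullet> (T - T ** ?E) = 0"
    using second_difference_trace_mat_power[of ?E 1 T] Esym Eidem by simp
  then have TE: "T = T ** ?E" by simp
  have "?E *v (T $ k) = T $ k"
  proof -
    have "transpose T = ?E ** transpose T"
      using arg_cong[OF TE, of transpose] Esym by (simp only: matrix_transpose_mul)
    then have "transpose T *v axis k 1 = ?E *v (transpose T *v axis k 1)"
      by (simp only: matrix_vector_mul_assoc)
    moreover have "transpose T *v axis k 1 = T $ k"
      by (simp add: matrix_vector_mult_basis column_def transpose_def del: transpose_matrix_vector)
    ultimately show ?thesis by simp
  qed
  moreover have supp: "?E $ l $ c > 0" if "T $ k $ c > 0" for c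
    using low[of l c] mult_pos_pos[OF Tkl that] by linarith
  ultimately obtain t where t: "T $ k = t *\<^sub>R ?E $ l"
    using nonneg_projection_fixed_vector[OF Enn P] pos Tkl by metis
  have "(T ** transpose T) $ k $ k = T $ k \<bullet> T $ k"
    by (simp add: matrix_matrix_mult_def transpose_def inner_vec_def)
  also have "\<dots> = t\<^sup>2 * (?E $ l \<bullet> ?E $ l)"
    by (simp add: t power2_eq_square)
  also have "?E $ l \<bullet> ?E $ l = (?E ** transpose ?E) $ l $ l"
    by (simp add: matrix_matrix_mult_def transpose_def inner_vec_def)
  finally have "(T ** transpose T) $ k $ k = t\<^sup>2 * ?E $ l $ l"
    by (simp only: Esym Eidem)
  moreover have "T $ k $ l = t * ?E $ l $ l"
    using arg_cong[OF t, of "\<lambda>v. v $ l"] by simp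
  ultimately have "(T ** transpose T) $ k $ k * ?E $ l $ l = (T $ k $ l)\<^sup>2"
    by (simp only: power2_eq_square mult_ac)
  then show ?thesis using Tkl by simp
qed

section \<open>Finiteness of the set of projections\<close>

text \<open>The mixed term is the trace of \<open>P ** Q\<close>. It is written through a Gram
  matrix because \<open>P ** Q\<close> need not be positive semidefinite, so its trace would not be
  covered by the finiteness assumption.\<close>

lemma dist_projections:
  fixes P Q :: "real^'n^'n"
  assumes "projection_matrix P" "projection_matrix Q"
  shows "(dist P Q)\<^sup>2 = trace P + trace Q - 2 * trace (transpose (P ** Q) ** (P ** Q))"
proof -
  have P: "transpose P = P" "P ** P = P" and Q: "transpose Q = Q" "Q ** Q = Q"
    using assms by (auto simp: projection_matrix_def)
  have "trace (transpose (P ** Q) ** (P ** Q)) = trace (Q ** (P ** Q))"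
    by (metis P Q matrix_mul_assoc matrix_transpose_mul)
  also have "\<dots> = trace (P ** Q)"
    by (metis Q(2) matrix_mul_assoc trace_mul_sym)
  finally have "trace (transpose (P ** Q) ** (P ** Q)) = P \<bullet> Q"
    by (metis P(1) trace_transpose_mult)
  moreover have "P \<bullet> P = trace P" "Q \<bullet> Q = trace Q"
    by (metis P trace_transpose_mult) (metis Q trace_transpose_mult)
  ultimately show ?thesis
    by (simp add: dist_norm power2_norm_eq_inner inner_diff_left inner_diff_right inner_commute)
qed

text \<open>Finitely many distances have a maximum and a least positive value, so the set is bounded
  and uniformly discrete.\<close>

lemma finite_if_finite_distances:
  fixes S :: "'a::heine_borel set"
  assumes "finite ((\<lambda>(x, y). dist x y) ` (S \<times> S))" (is "finite ?D")
  shows "finite S"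
proof (cases "S = {}")
  case False
  then obtain s where s: "s \<in> S" by blast
  have "dist s x \<le> Max ?D" if "x \<in> S" for x
    using assms s that by (intro Max_ge) auto
  then have "bounded S" by (auto simp: bounded_def)
  \<comment> \<open>Inserting 1 keeps the minimum defined when no positive distance occurs.\<close>
  define e where "e = Min (insert 1 (?D - {0}))"
  have "e > 0" using assms by (auto simp: e_def)
  moreover have "e \<le> dist x y" if "x \<in> S" "y \<in> S" "x \<noteq> y" for x y
    unfolding e_def using assms that by (intro Min_le) auto
  ultimately have "uniform_discrete S" by (rule uniformI2)
  with \<open>bounded S\<close> show ?thesis using uniform_discrete_finite_iff by blast
qed simp

lemma finite_projections:
  assumes "mult_semigroup \<S>" "selfadjoint_collection \<S>"
    and fin: "finite {trace S | S. S \<in> pos_part \<S>}" (is "finite ?T")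
  shows "finite (projections \<S>)"
proof (rule finite_if_finite_distances)
  have *: "trace (transpose S ** S) \<in> ?T" if "S \<in> \<S>" for S
    using assms(1,2) that pos_semidef_transpose_mult[of S]
    unfolding mult_semigroup_def selfadjoint_collection_def pos_part_def by blast
  have "dist P Q \<in> (\<lambda>(a, b, c). sqrt (a + b - 2 * c)) ` (?T \<times> ?T \<times> ?T)"
    if "P \<in> projections \<S>" "Q \<in> projections \<S>" for P Q
  proof -
    have P: "P \<in> \<S>" "projection_matrix P" and Q: "Q \<in> \<S>" "projection_matrix Q"
      using that by (auto simp: projections_def)
    have PQ: "P ** Q \<in> \<S>" using P Q assms(1) by (auto simp: mult_semigroup_def)
    have "dist P Q = sqrt (trace P + trace Q - 2 * trace (transpose (P ** Q) ** (P ** Q)))"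
      by (metis dist_projections[OF P(2) Q(2)] real_sqrt_unique zero_le_dist)
    \<comment> \<open>A projection is its own Gram matrix.\<close>
    moreover have "trace P \<in> ?T" "trace Q \<in> ?T"
      using *[OF P(1)] *[OF Q(1)] P(2) Q(2) by (simp_all add: projection_matrix_def)
    ultimately show ?thesis
      using *[OF PQ] by (intro image_eqI[of _ _
          "(trace P, trace Q, trace (transpose (P ** Q) ** (P ** Q)))"]) simp_all
  qed
  then show "finite ((\<lambda>(P, Q). dist P Q) ` (projections \<S> \<times> projections \<S>))"
    by (intro finite_subset[OF _ finite_imageI[of "?T \<times> ?T \<times> ?T" "\<lambda>(a, b, c). sqrt (a + b - 2 * c)"]])
      (use fin in auto)
qed

lemma finite_matrices_with_entries_in:
  assumes "finite V"
  shows "finite {A :: 'a^'n^'m. \<forall>i j. A $ i $ j \<in> V}"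
proof (rule finite_subset)
  let ?F = "UNIV \<rightarrow>\<^sub>E (UNIV \<rightarrow>\<^sub>E V) :: ('m \<Rightarrow> 'n \<Rightarrow> 'a) set"
  show "finite ((\<lambda>f. \<chi> i j. f i j) ` ?F)"
    using assms by (intro finite_imageI finite_PiE) auto
  show "{A :: 'a^'n^'m. \<forall>i j. A $ i $ j \<in> V} \<subseteq> (\<lambda>f. \<chi> i j. f i j) ` ?F"
  proof
    fix A :: "'a^'n^'m" assume "A \<in> {A. \<forall>i j. A $ i $ j \<in> V}"
    then show "A \<in> (\<lambda>f. \<chi> i j. f i j) ` ?F"
      by (intro image_eqI[of _ _ "\<lambda>i j. A $ i $ j"]) (auto simp: vec_eq_iff)
  qed
qed

theorem corollary4p7:
  fixes \<S> :: "(real^'n^'n) set"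
  assumes "mult_semigroup \<S>"
    and "selfadjoint_collection \<S>"
    and "\<forall>S\<in>\<S>. nonneg_matrix S"
    and "finite {trace S | S. S \<in> pos_part \<S>}"
  shows "(\<forall>A\<in>\<S>. \<forall>i j. A $ i $ j \<noteq> 0 \<longrightarrow>
            (\<exists>\<xi>\<in>diagonal_values (projections \<S>). \<exists>\<eta>\<in>diagonal_values (projections \<S>).
               A $ i $ j = sqrt (\<xi> * \<eta>)))
         \<and> finite \<S>"
proof
  \<comment> \<open>All positive powers of the Gram matrix of \<open>S\<close> lie in
    \<open>\<S>\<close> and are positive semidefinite, so their traces take finitely many
    values.\<close>
  have gram: "transpose S ** S \<in> projections \<S>" if "S \<in> \<S>" for S
  proof -
    let ?A = "transpose S ** S"
    have A: "?A \<in> \<S>"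
      using assms(1,2) that by (auto simp: mult_semigroup_def selfadjoint_collection_def)
    have "mat_power ?A (Suc k) \<in> \<S>" for k
    proof (induction k)
      case (Suc k)
      then show ?case using A assms(1) by (simp add: mult_semigroup_def)
    qed (simp add: A)
    moreover have "pos_semidef (mat_power ?A (Suc k))" for k
      using mat_power_gram[of "Suc k" S] pos_semidef_transpose_mult by metis
    ultimately have "range (\<lambda>k. trace (mat_power ?A (Suc k))) \<subseteq> {trace S | S. S \<in> pos_part \<S>}"
      by (auto simp only: pos_part_def)
    then have "projection_matrix ?A"
      using assms(4) by (intro gram_projection_if_finite_traces) (rule finite_subset)
    with A show ?thesis by (simp add: projections_def)
  qed
  let ?D = "diagonal_values (projections \<S>)"
  show entries: "\<forall>A\<in>\<S>. \<forall>i j. A $ i $ j \<noteq> 0 \<longrightarrow> (\<exists>\<xi>\<in>?D. \<exists>\<eta>\<in>?D. A $ i $ j = sqrt (\<xi> * \<eta>))"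
  proof (intro ballI allI impI)
    fix A i j assume A: "A \<in> \<S>" and "A $ i $ j \<noteq> 0"
    have "transpose A \<in> \<S>" using A assms(2) by (simp add: selfadjoint_collection_def)
    then have "A ** transpose A \<in> projections \<S>" using gram[of "transpose A"] by simp
    then have "(A ** transpose A) $ i $ i \<in> ?D" "(transpose A ** A) $ j $ j \<in> ?D"
      using gram[OF A] by (auto simp: diagonal_values_def)
    moreover have "A $ i $ j = sqrt ((A ** transpose A) $ i $ i * (transpose A ** A) $ j $ j)"
      using assms(3) A gram[OF A] \<open>A $ i $ j \<noteq> 0\<close>
      by (intro nonneg_partial_isometry_entry) (auto simp: projections_def)
    ultimately show "\<exists>\<xi>\<in>?D. \<exists>\<eta>\<in>?D. A $ i $ j = sqrt (\<xi> * \<eta>)" by blast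
  qed
  have "?D = (\<lambda>(P, k). P $ k $ k) ` (projections \<S> \<times> UNIV)"
    by (auto simp: diagonal_values_def)
  then have "finite ?D"
    using finite_projections[OF assms(1,2,4)] by simp
  \<comment> \<open>The square roots account for nonzero entries only, hence the extra 0.\<close>
  then have "finite (insert 0 ((\<lambda>(\<xi>, \<eta>). sqrt (\<xi> * \<eta>)) ` (?D \<times> ?D)))" (is "finite ?V")
    by simp
  then have "finite {A :: real^'n^'n. \<forall>i j. A $ i $ j \<in> ?V}"
    by (rule finite_matrices_with_entries_in)
  moreover have "\<S> \<subseteq> {A. \<forall>i j. A $ i $ j \<in> ?V}"
  proof (intro subsetI CollectI allI)
    fix A i j assume A: "A \<in> \<S>"
    show "A $ i $ j \<in> ?V"
    proof (cases "A $ i $ j = 0")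
      case False
      then obtain \<xi> \<eta> where "\<xi> \<in> ?D" "\<eta> \<in> ?D" "A $ i $ j = sqrt (\<xi> * \<eta>)"
        using entries A by blast
      then show ?thesis by (intro insertI2 image_eqI[of _ _ "(\<xi>, \<eta>)"]) simp_all
    qed simp
  qed
  ultimately show "finite \<S>" by (rule finite_subset[rotated])
qed

end
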